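(* Let $P=\varrho(x,y)\,\partial_x\wedge\partial_y$ be a Poisson bivector on $\mathbb{R}^2$ and let $$\vec{X}^{\gamma_3}_{2D}=\phi([0,1;1,3;1,2])+2\,\phi([0,3;1,3;1,2])\in\mathcal{V}_{2D},$$ which solves the trivialization equation $Q^{\gamma_3}(P)=[\![P,\vec{X}^{\gamma_3}_{2D}]\!]$ for the tetrahedral flow (with $Q^{\gamma_3}$ normalized by a suitable nonzero constant). Then $\vec{X}^{\gamma_3}_{2D}$ is unique modulo Hamiltonian vector fields: for every $\vec{X}\in\mathcal{V}_{2D}$ with $Q^{\gamma_3}(P)=[\![P,\vec{X}]\!]$ there is $H\in\mathcal{H}_{2D}$ such that $\vec{X}-\vec{X}^{\gamma_3}_{2D}=[\![P,H]\!]$.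
   Context: $[\![\cdot,\cdot]\!]$ is the Schouten bracket of multivector fields. Tetrahedral flow: let $\gamma_3$ be the complete graph on vertices $1,2,3,4$ with its six edges ordered $12\prec13\prec14\prec23\prec24\prec34$. Write $P=\tfrac12P^{ij}\xi_i\xi_j$ with anticommuting $\xi_i=\partial/\partial x^i$. Up to a nonzero normalization constant, $Q^{\gamma_3}(P)$ is the bivector obtained by applying to $P\otimes P\otimes P\otimes P$, for the edges $(a,b)$ in this order, the operators $\sum_\mu\big(\tfrac{\partial}{\partial\xi_\mu^{(a)}}\tfrac{\partial}{\partial x^\mu_{(b)}}+\tfrac{\partial}{\partial\xi_\mu^{(b)}}\tfrac{\partial}{\partial x^\mu_{(a)}}\big)$ (superscripts/subscripts $(a)$ denote the tensor factor acted on), and then multiplying the four factors. A two-dimensional Kontsevich graph on $n$ Levi-Civita vertices $1,\dots,n$ and at most one sink $0$ is a weakly connected directed graph in which each Levi-Civita vertex issues an ordered pair of edges to two distinct targets (self-loops allowed), the sink issues no edges, and the sink, if present, receives exactly one edge. It is encoded by $[t_{11},t_{12};\dots;t_{n1},t_{n2}]$, where $t_{k1},t_{k2}$ are the targets of the ordered edges issued from vertex $k$. The evaluation $\phi$ sends such a graph to a function (no sink) or a vector field (one sink): decorate the $k$-th pair of edges with indices $i_{k1},i_{k2}\in\{1,2\}$; form $\prod_k\varepsilon^{i_{k1}i_{k2}}$ ($\varepsilon$ the Levi-Civita symbol, $\varepsilon^{12}=1$) times the product over Levi-Civita vertices of $\varrho$ differentiated with respect to $x^{i}$ ($x^1=x$,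 $x^2=y$) for each incoming edge with index $i$, times $\partial_{x^{i}}$ if the edge with index $i$ enters the sink; sum over all indices. $\mathcal{H}_{2D}$ is the real span of $\phi(\Gamma)$ over graphs on two Levi-Civita vertices and no sink; $\mathcal{V}_{2D}$ is the real span of $\phi(\Gamma)$ over graphs on three Levi-Civita vertices and one sink. A vector field is called Hamiltonian if it equals $[\![P,H]\!]$ for a function $H$ obtained from graphs. The coefficient $\varrho$ is treated as an arbitrary (generic) smooth function: elements of these spaces are differential-polynomial expressions in $\varrho$ with constant coefficients, and equalities are required to hold identically for all smooth $\varrho$. *)

theory Defs
  imports "HOL-Analysis.Analysis" "HOL-Library.Function_Algebras"
begin

text \<open>
  Indices \<open>i \<in> {1, 2}\<close> are elements of the numeral type \<open>2\<close> (in which \<open>2 = 0\<close>), points of the plane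
  are \<open>p :: real ^ 2\<close> with coordinates \<open>x = p $ 1\<close> and \<open>y = p $ 2\<close>.  Ring operations on functions
  are pointwise.
\<close>

type_synonym fn = "real ^ 2 \<Rightarrow> real"

definition partial :: "2 \<Rightarrow> fn \<Rightarrow> fn" where
  "partial i f = (\<lambda>p. deriv (\<lambda>t. f (p + t *\<^sub>R axis i 1)) 0)"

definition partials :: "2 list \<Rightarrow> fn \<Rightarrow> fn" where
  "partials is f = foldr partial is f"

text \<open>All iterated partial derivatives are (totally) differentiable, hence also continuous.\<close>

definition smooth :: "fn \<Rightarrow> bool" where
  "smooth f \<longleftrightarrow> (\<forall>is. partials is f differentiable_on UNIV)"


section \<open>Multivector fields on the plane\<close>

text \<open>
  \<open>MV f a b c\<close> is the multivector field \<open>f + a \<xi>\<^sub>1 + b \<xi>\<^sub>2 + c \<xi>\<^sub>1 \<xi>\<^sub>2\<close>, where \<open>\<xi>\<^sub>1 = \<partial>\<^sub>x\<close> and \<open>\<xi>\<^sub>2 = \<partial>\<^sub>y\<close> anticommute;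
  the product below is the wedge product.
\<close>

datatype mvf = MV fn fn fn fn

instantiation mvf :: real_algebra_1
begin

definition zero_mvf :: mvf where "0 = MV 0 0 0 0"

definition one_mvf :: mvf where "1 = MV 1 0 0 0"

fun plus_mvf :: "mvf \<Rightarrow> mvf \<Rightarrow> mvf" where
  "MV f a b c + MV f' a' b' c' = MV (f + f') (a + a') (b + b') (c + c')"

fun uminus_mvf :: "mvf \<Rightarrow> mvf" where
  "- MV f a b c = MV (- f) (- a) (- b) (- c)"

fun minus_mvf :: "mvf \<Rightarrow> mvf \<Rightarrow> mvf" where
  "MV f a b c - MV f' a' b' c' = MV (f - f') (a - a') (b - b') (c - c')"

fun times_mvf :: "mvf \<Rightarrow> mvf \<Rightarrow> mvf" where
  "MV f a b c * MV f' a' b' c' =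
     MV (f * f') (f * a' + a * f') (f * b' + b * f') (f * c' + a * b' - b * a' + c * f')"

fun scaleR_mvf :: "real \<Rightarrow> mvf \<Rightarrow> mvf" where
  "r *\<^sub>R MV f a b c = MV (\<lambda>p. r * f p) (\<lambda>p. r * a p) (\<lambda>p. r * b p) (\<lambda>p. r * c p)"

instance
proof
  fix u v w :: mvf and r s :: real
  show "u + v + w = u + (v + w)" by (cases u; cases v; cases w) (simp add: algebra_simps)
  show "u + v = v + u" by (cases u; cases v) (simp add: algebra_simps)
  show "0 + u = u" by (cases u) (simp add: zero_mvf_def)
  show "- u + u = 0" by (cases u) (simp add: zero_mvf_def)
  show "u - v = u + - v" by (cases u; cases v) simp
  show "u * v * w = u * (v * w)" by (cases u; cases v; cases w) (simp add: algebra_simps)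
  show "1 * u = u" by (cases u) (simp add: one_mvf_def)
  show "u * 1 = u" by (cases u) (simp add: one_mvf_def)
  show "(u + v) * w = u * w + v * w" by (cases u; cases v; cases w) (simp add: algebra_simps)
  show "u * (v + w) = u * v + u * w" by (cases u; cases v; cases w) (simp add: algebra_simps)
  show "(0::mvf) \<noteq> 1" by (simp add: zero_mvf_def one_mvf_def)
  show "r *\<^sub>R (u + v) = r *\<^sub>R u + r *\<^sub>R v" by (cases u; cases v) (auto simp: fun_eq_iff algebra_simps)
  show "(r + s) *\<^sub>R u = r *\<^sub>R u + s *\<^sub>R u" by (cases u) (auto simp: fun_eq_iff algebra_simps)
  show "r *\<^sub>R s *\<^sub>R u = (r * s) *\<^sub>R u" by (cases u) (auto simp: fun_eq_iff algebra_simps)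
  show "1 *\<^sub>R u = u" by (cases u) simp
  show "(r *\<^sub>R u) * v = r *\<^sub>R (u * v)" by (cases u; cases v) (auto simp: fun_eq_iff algebra_simps)
  show "u * (r *\<^sub>R v) = r *\<^sub>R (u * v)" by (cases u; cases v) (auto simp: fun_eq_iff algebra_simps)
qed

end

definition scal :: "fn \<Rightarrow> mvf" where
  "scal f = MV f 0 0 0"

definition xi :: "2 \<Rightarrow> mvf" where
  "xi i = (if i = 1 then MV 0 1 0 0 else MV 0 0 1 0)"

fun dx :: "2 \<Rightarrow> mvf \<Rightarrow> mvf" where
  "dx i (MV f a b c) = MV (partial i f) (partial i a) (partial i b) (partial i c)"

text \<open>The left derivative with respect to \<open>\<xi>\<^sub>i\<close>.\<close>

fun dxi :: "2 \<Rightarrow> mvf \<Rightarrow> mvf" where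
  "dxi i (MV f a b c) = (if i = 1 then MV a 0 c 0 else MV b (- c) 0 0)"

text \<open>The parity operator \<open>F \<mapsto> (- 1) ^ k F\<close> on fields of degree \<open>k\<close>.\<close>

fun parity :: "mvf \<Rightarrow> mvf" where
  "parity (MV f a b c) = MV f (- a) (- b) c"

text \<open>
  The Schouten bracket, as the odd Poisson bracket with right derivatives acting on the first and
  left derivatives acting on the second argument.  The right derivative of \<open>F\<close> with respect to \<open>\<xi>\<^sub>i\<close>
  is \<open>parity (dxi i F)\<close>.
\<close>

definition schouten :: "mvf \<Rightarrow> mvf \<Rightarrow> mvf" (\<open>\<lbrakk>_,/ _\<rbrakk>\<^sub>S\<close>) where
  "\<lbrakk>F, G\<rbrakk>\<^sub>S = (\<Sum>i\<in>UNIV. parity (dxi i F) * dx i G - dx i F * dxi i G)"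

definition Poisson :: "fn \<Rightarrow> mvf" where
  "Poisson \<rho> = scal \<rho> * xi 1 * xi 2"


section \<open>The tetrahedral flow\<close>

text \<open>
  A decomposable tensor \<open>F\<^sub>1 \<otimes> F\<^sub>2 \<otimes> F\<^sub>3 \<otimes> F\<^sub>4\<close> is given by its factors \<open>F v\<close>.  The odd derivation with
  respect to \<open>\<xi>\<^sub>i\<close> in factor \<open>a\<close> acquires the Koszul sign of moving past the factors before \<open>a\<close>.
\<close>

definition dxi_at :: "nat \<Rightarrow> 2 \<Rightarrow> (nat \<Rightarrow> mvf) \<Rightarrow> nat \<Rightarrow> mvf" where
  "dxi_at a i F = (\<lambda>v. if v < a then parity (F v) else if v = a then dxi i (F v) else F v)"

definition dx_at :: "nat \<Rightarrow> 2 \<Rightarrow> (nat \<Rightarrow> mvf) \<Rightarrow> nat \<Rightarrow> mvf" where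
  "dx_at b i F = F(b := dx i (F b))"

text \<open>Apply the edge operators, the head of the list first, and multiply the four factors.\<close>

fun contract :: "(nat \<times> nat) list \<Rightarrow> (nat \<Rightarrow> mvf) \<Rightarrow> mvf" where
  "contract [] F = F 1 * F 2 * F 3 * F 4"
| "contract ((a, b) # es) F =
     (\<Sum>i\<in>UNIV. contract es (dxi_at a i (dx_at b i F)) + contract es (dxi_at b i (dx_at a i F)))"

definition tetrahedral_flow :: "mvf \<Rightarrow> mvf" where
  "tetrahedral_flow P = contract [(1,2), (1,3), (1,4), (2,3), (2,4), (3,4)] (\<lambda>_. P)"


section \<open>Graphs and their evaluation\<close>

text \<open>
  \<open>[(t\<^sub>1\<^sub>1, t\<^sub>1\<^sub>2), \<dots>, (t\<^sub>n\<^sub>1, t\<^sub>n\<^sub>2)]\<close> lists the targets of the edges issued from the Levi-Civita vertices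
  \<open>1, \<dots>, n\<close>; the sink is \<open>0\<close>.
\<close>

type_synonym lc_graph = "(nat \<times> nat) list"

definition edges :: "lc_graph \<Rightarrow> (nat \<times> nat) set" where
  "edges g = {(k, t). k \<in> {1..length g} \<and> (t = fst (g ! (k - 1)) \<or> t = snd (g ! (k - 1)))}"

definition vertices :: "bool \<Rightarrow> nat \<Rightarrow> nat set" where
  "vertices sink n = (if sink then {0..n} else {1..n})"

definition lc_graphs :: "bool \<Rightarrow> nat \<Rightarrow> lc_graph set" where
  "lc_graphs sink n = {g. length g = n
     \<and> (\<forall>(s, t) \<in> set g. s \<in> vertices sink n \<and> t \<in> vertices sink n \<and> s \<noteq> t)
     \<and> (sink \<longrightarrow> count_list (map fst g @ map snd g) 0 = 1)
     \<and> (\<forall>u \<in> vertices sink n. \<forall>v \<in> vertices sink n. (u, v) \<in> (edges g \<union> (edges g)\<inverse>)\<^sup>*)}"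

definition levi_civita :: "2 \<Rightarrow> 2 \<Rightarrow> real" where
  "levi_civita i j = (if i = 1 \<and> j = 2 then 1 else if i = 2 \<and> j = 1 then - 1 else 0)"

text \<open>
  The indices of the edges that enter \<open>v\<close>, when the pair of edges issued from vertex \<open>k\<close> is decorated
  with the \<open>k\<close>-th pair in \<open>is\<close>.
\<close>

definition incoming :: "lc_graph \<Rightarrow> (2 \<times> 2) list \<Rightarrow> nat \<Rightarrow> 2 list" where
  "incoming g is v = concat (map2 (\<lambda>(s, t) (i, j).
     (if s = v then [i] else []) @ (if t = v then [j] else [])) g is)"

definition phi :: "lc_graph \<Rightarrow> fn \<Rightarrow> mvf" where
  "phi g \<rho> = (\<Sum>is\<in>{is. length is = length g}.
     (\<Prod>(i, j)\<leftarrow>is. levi_civita i j) *\<^sub>R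
     ((\<Prod>k\<leftarrow>[1..<Suc (length g)]. scal (partials (incoming g is k) \<rho>)) *
      (\<Prod>i\<leftarrow>incoming g is 0. xi i)))"

text \<open>
  Elements of the spans are the operators that send an arbitrary \<open>\<rho>\<close> to a function or vector field
  (differential polynomials in \<open>\<rho>\<close> with constant coefficients), as opposed to their values at
  one \<open>\<rho>\<close>.
\<close>

interpretation diffpoly: vector_space "\<lambda>(r::real) (X :: fn \<Rightarrow> mvf) \<rho>. r *\<^sub>R X \<rho>"
  by unfold_locales (auto simp: fun_eq_iff scaleR_add_left scaleR_add_right)

definition H2D :: "(fn \<Rightarrow> mvf) set" where
  "H2D = diffpoly.span (phi ` lc_graphs False 2)"

definition V2D :: "(fn \<Rightarrow> mvf) set" where
  "V2D = diffpoly.span (phi ` lc_graphs True 3)"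

definition X_tetra :: "fn \<Rightarrow> mvf" where
  "X_tetra \<rho> = phi [(0,1), (1,3), (1,2)] \<rho> + 2 *\<^sub>R phi [(0,3), (1,3), (1,2)] \<rho>"

end

(*
  On smooth \<rho>, every graph on three Levi-Civita vertices and a sink evaluates to a multiple of one of
  three vector fields A, B, C, and X_tetra = B + 2 C.  The field A is half of [P, H] for the graph H
  whose value is twice the Hessian determinant of \<rho>, so [P, A] = 0.  The brackets [P, B] and [P, C]
  are linearly independent: on \<alpha> + y + y^2/2 + x^3/6 they take the values 1 - 2 \<alpha> and \<alpha> at the
  origin.  Hence every solution of the trivialization equation is of the form a A + B + 2 C.
*)

theory Submission
  imports Defs
begin

section \<open>Calculus of smooth functions\<close>

text \<open>Why three fields: six edges leave the Levi-Civita vertices and one enters the sink, so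
  five derivatives fall on three copies of \<rho>. The two targets of a vertex differ, so no copy
  receives more than three. The orders are therefore 0, 2, 3 or 1, 1, 3 or 1, 2, 2, which are the
  types of A, B and C. The scalar factor still depends on the graph and is found by evaluating each
  graph after sorting its target pairs, which changes only the sign. Members of the spans act on
  arbitrary functions, but mixed partials commute only under regularity, so every evaluation is
  stated for smooth \<rho>. The coefficient 2 in \<open>X_tetra\<close> is forced: the flow contains
  no undifferentiated \<rho>, and the part of [P, B] that does is exactly -2 [P, C].\<close>

lemma has_real_derivative_partial:
  assumes "f differentiable (at p)"
  shows "((\<lambda>t. f (p + t *\<^sub>R axis i 1)) has_real_derivative partial i f p) (at 0)"
proof -
  have "(\<lambda>t::real. p + t *\<^sub>R axis i 1) differentiable (at 0)"
    by (intro derivative_intros) 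
  then have "(\<lambda>t. f (p + t *\<^sub>R axis i 1)) differentiable (at (0::real))"
    using differentiable_chain_at[of "\<lambda>t. p + t *\<^sub>R axis i 1" 0 f] assms by (simp add: o_def)
  then show ?thesis
    unfolding partial_def by (simp add: DERIV_deriv_iff_real_differentiable)
qed

text \<open>The mean value theorem needs the derivative at each parameter of a line, while
  \<open>partial\<close> is a derivative at parameter 0; moving the base point bridges the
  two.\<close>

lemma has_real_derivative_line:
  assumes "f differentiable_on UNIV"
  shows "((\<lambda>t. f (p + t *\<^sub>R axis i 1)) has_real_derivative partial i f (p + s *\<^sub>R axis i 1)) (at s)"
proof -
  have "((\<lambda>t. f ((p + s *\<^sub>R axis i 1) + t *\<^sub>R axis i 1)) has_real_derivative
      partial i f (p + s *\<^sub>R axis i 1)) (at 0)"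
    using assms by (intro has_real_derivative_partial) (auto simp: differentiable_on_def)
  then show ?thesis
    using DERIV_shift[of "\<lambda>t. f (p + t *\<^sub>R axis i 1)" _ 0 s] by (simp add: algebra_simps)
qed

lemma partial_add:
  assumes "f differentiable_on UNIV" "g differentiable_on UNIV"
  shows "partial i (f + g) = partial i f + partial i g"
proof
  fix p
  have "((\<lambda>t. f (p + t *\<^sub>R axis i 1) + g (p + t *\<^sub>R axis i 1)) has_real_derivative
      partial i f p + partial i g p) (at 0)"
    using assms by (intro DERIV_add has_real_derivative_partial) (auto simp: differentiable_on_def)
  then show "partial i (f + g) p = (partial i f + partial i g) p"
    unfolding partial_def[of i "f + g"] by (simp add: DERIV_imp_deriv)
qed

lemma partial_mult:
  assumes "f differentiable_on UNIV" "g differentiable_on UNIV"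
  shows "partial i (f * g) = partial i f * g + f * partial i g"
proof
  fix p
  have "((\<lambda>t. f (p + t *\<^sub>R axis i 1) * g (p + t *\<^sub>R axis i 1)) has_real_derivative
      partial i f p * g (p + 0 *\<^sub>R axis i 1) + partial i g p * f (p + 0 *\<^sub>R axis i 1)) (at 0)"
    using assms by (intro DERIV_mult has_real_derivative_partial) (auto simp: differentiable_on_def)
  then show "partial i (f * g) p = (partial i f * g + f * partial i g) p"
    unfolding partial_def[of i "f * g"] by (simp add: DERIV_imp_deriv mult.commute)
qed

lemma partial_const: "partial i (\<lambda>p. c) = 0"
  by (simp add: partial_def fun_eq_iff)

text \<open>The second difference of \<open>f\<close> is symmetric in \<open>i\<close> and \<open>j\<close>, hence mixed partials commute.\<close>

lemma second_difference_eq_partial: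
  assumes f: "f differentiable_on UNIV" "partial i f differentiable_on UNIV" and h: "0 < h"
  obtains s t where "0 < s" "s < h" "0 < t" "t < h"
    "f (p + h *\<^sub>R axis i 1 + h *\<^sub>R axis j 1) - f (p + h *\<^sub>R axis i 1) - f (p + h *\<^sub>R axis j 1) + f p
      = h * h * partial j (partial i f) (p + s *\<^sub>R axis i 1 + t *\<^sub>R axis j 1)"
proof -
  let ?a = "axis i (1::real) :: real ^ 2" and ?b = "axis j (1::real) :: real ^ 2"
  \<comment> \<open>The increment across \<open>?b\<close>, as a function along \<open>?a\<close>:
    the mean value theorem yields \<open>partial i f\<close> at two points, which a second
    application compares along \<open>?b\<close>.\<close>
  let ?g = "\<lambda>s. f (p + h *\<^sub>R ?b + s *\<^sub>R ?a) - f (p + s *\<^sub>R ?a)"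
  have "\<exists>s>0. s < h \<and> ?g h - ?g 0
      = (h - 0) * (partial i f (p + h *\<^sub>R ?b + s *\<^sub>R ?a) - partial i f (p + s *\<^sub>R ?a))"
    using h by (intro MVT2 DERIV_diff has_real_derivative_line f)
  then obtain s where s: "0 < s" "s < h" and eq1: "?g h - ?g 0
      = h * (partial i f (p + h *\<^sub>R ?b + s *\<^sub>R ?a) - partial i f (p + s *\<^sub>R ?a))"
    by auto
  let ?k = "\<lambda>t. partial i f (p + s *\<^sub>R ?a + t *\<^sub>R ?b)"
  have "\<exists>t>0. t < h \<and> ?k h - ?k 0 = (h - 0) * partial j (partial i f) (p + s *\<^sub>R ?a + t *\<^sub>R ?b)"
    using h by (intro MVT2 has_real_derivative_line f)
  then obtain t where t: "0 < t" "t < h"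
    and eq2: "?k h - ?k 0 = h * partial j (partial i f) (p + s *\<^sub>R ?a + t *\<^sub>R ?b)"
    by auto
  show thesis
    using eq1 eq2 by (intro that[OF s t]) (simp add: algebra_simps)
qed

lemma partial_commute:
  assumes f: "f differentiable_on UNIV" "\<And>i. partial i f differentiable_on UNIV"
    and cont: "\<And>i j. continuous_on UNIV (partial j (partial i f))"
  shows "partial j (partial i f) = partial i (partial j f)"
proof
  fix p
  let ?u = "partial j (partial i f)" and ?v = "partial i (partial j f)"
  have "dist (?u p) (?v p) \<le> e" if "0 < e" for e
  proof -
    have "isCont ?u p" "isCont ?v p"
      using cont by (auto simp: continuous_on_eq_continuous_at)
    then obtain d1 d2 where d: "0 < d1" "\<And>q. dist q p < d1 \<Longrightarrow> dist (?u q) (?u p) < e / 2"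
      "0 < d2" "\<And>q. dist q p < d2 \<Longrightarrow> dist (?v q) (?v p) < e / 2"
      using \<open>0 < e\<close> unfolding continuous_at_eps_delta by (metis half_gt_zero)
    \<comment> \<open>Each intermediate point is reached by two displacements shorter than
      \<open>h\<close>, hence lies within \<open>2 * h\<close> of \<open>p\<close>.\<close>
    define h where "h = min d1 d2 / 2"
    have h: "0 < h" "2 * h \<le> d1" "2 * h \<le> d2"
      using d by (auto simp: h_def)
    obtain s t where st: "0 < s" "s < h" "0 < t" "t < h"
      "f (p + h *\<^sub>R axis i 1 + h *\<^sub>R axis j 1) - f (p + h *\<^sub>R axis i 1) - f (p + h *\<^sub>R axis j 1) + f p
        = h * h * ?u (p + s *\<^sub>R axis i 1 + t *\<^sub>R axis j 1)"
      using second_difference_eq_partial[OF f h(1)] by metis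
    obtain s' t' where st': "0 < s'" "s' < h" "0 < t'" "t' < h"
      "f (p + h *\<^sub>R axis j 1 + h *\<^sub>R axis i 1) - f (p + h *\<^sub>R axis j 1) - f (p + h *\<^sub>R axis i 1) + f p
        = h * h * ?v (p + s' *\<^sub>R axis j 1 + t' *\<^sub>R axis i 1)"
      using second_difference_eq_partial[OF f h(1)] by metis
    let ?q = "p + s *\<^sub>R axis i 1 + t *\<^sub>R axis j 1" and ?q' = "p + s' *\<^sub>R axis j 1 + t' *\<^sub>R axis i 1"
    have near: "dist (p + a *\<^sub>R axis k 1 + b *\<^sub>R axis l 1) p < 2 * h"
      if "0 < a" "a < h" "0 < b" "b < h" for a b and k l :: 2
    proof -
      have "dist (p + a *\<^sub>R axis k 1 + b *\<^sub>R axis l 1) p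
          \<le> norm (a *\<^sub>R axis k 1 :: real ^ 2) + norm (b *\<^sub>R axis l 1 :: real ^ 2)"
        using norm_triangle_ineq[of "a *\<^sub>R axis k 1" "b *\<^sub>R axis l 1 :: real ^ 2"]
        by (simp add: dist_norm add.assoc)
      also have "\<dots> < 2 * h"
        using that by (simp add: norm_axis_1)
      finally show ?thesis .
    qed
    have "h * h * ?u ?q = h * h * ?v ?q'"
      using st(5) st'(5) by (simp add: algebra_simps)
    then have "?u ?q = ?v ?q'"
      using h by simp
    moreover have "dist (?u ?q) (?u p) < e / 2" "dist (?v ?q') (?v p) < e / 2"
      using d near[OF st(1-4), of i j] near[OF st'(1-4), of j i] h by (auto intro: less_le_trans)
    ultimately show ?thesis
      using dist_triangle_half_l[of "?u p" "?u ?q" e "?v p"] by (simp add: dist_commute dist_real_def)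
  qed
  then show "?u p = ?v p"
    using field_le_epsilon[of "dist (?u p) (?v p)" 0] by simp
qed

section \<open>Smooth functions and their closure properties\<close>

lemma smooth_differentiable: "smooth f \<Longrightarrow> f differentiable_on UNIV"
  by (auto simp: smooth_def partials_def dest: spec[of _ "[]"])

lemma smooth_partial: "smooth f \<Longrightarrow> smooth (partial i f)"
  unfolding smooth_def
proof
  fix "is" assume "\<forall>is. partials is f differentiable_on UNIV"
  then have "partials (is @ [i]) f differentiable_on UNIV" ..
  then show "partials is (partial i f) differentiable_on UNIV" by (simp add: partials_def)
qed

lemma smooth_continuous: "smooth f \<Longrightarrow> continuous_on UNIV f"
  by (simp add: smooth_differentiable differentiable_imp_continuous_on)

text \<open>As a rewrite rule this moves \<open>partial 1\<close> outwards and gives iterated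
  partials a normal form, so that identities between differential polynomials become ring
  identities.\<close>

lemma partial_2_1: "smooth f \<Longrightarrow> partial 2 (partial 1 f) = partial 1 (partial 2 f)"
  by (intro partial_commute smooth_differentiable smooth_continuous smooth_partial)

lemma partial_minus: "smooth f \<Longrightarrow> partial i (- f) = - partial i f"
proof
  fix p
  assume "smooth f"
  then have "((\<lambda>t. - f (p + t *\<^sub>R axis i 1)) has_real_derivative - partial i f p) (at 0)"
    by (intro DERIV_minus has_real_derivative_partial) (auto simp: differentiable_on_def dest: smooth_differentiable)
  then show "partial i (- f) p = (- partial i f) p"
    unfolding partial_def[of i "- f"] by (simp add: DERIV_imp_deriv)
qed

lemma partial_zero: "partial i 0 = 0"
  using partial_const[of i 0] by (simp add: zero_fun_def)

lemma smooth_coinduct: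
  assumes "f \<in> S" and S: "\<And>g. g \<in> S \<Longrightarrow> g differentiable_on UNIV" "\<And>g i. g \<in> S \<Longrightarrow> partial i g \<in> S"
  shows "smooth f"
proof -
  have "partials is f \<in> S" for "is"
    by (induction "is") (auto simp: partials_def assms)
  then show ?thesis
    unfolding smooth_def using S(1) by blast
qed

text \<open>Smoothness is coinductive, so it suffices to close the smooth functions under ring operations.\<close>

inductive smooth_ring :: "fn \<Rightarrow> bool" where
  smooth: "smooth f \<Longrightarrow> smooth_ring f"
| add: "smooth_ring f \<Longrightarrow> smooth_ring g \<Longrightarrow> smooth_ring (f + g)"
| mult: "smooth_ring f \<Longrightarrow> smooth_ring g \<Longrightarrow> smooth_ring (f * g)"

lemma smooth_ring_differentiable: "smooth_ring f \<Longrightarrow> f differentiable_on UNIV"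
  by (induction rule: smooth_ring.induct)
    (auto simp: smooth_differentiable plus_fun_def times_fun_def intro!: derivative_intros)

lemma smooth_ring_partial: "smooth_ring f \<Longrightarrow> smooth_ring (partial i f)"
proof (induction rule: smooth_ring.induct)
  case (smooth f)
  then show ?case by (intro smooth_ring.smooth smooth_partial)
next
  case (add f g)
  then show ?case
    by (simp only: partial_add[OF smooth_ring_differentiable smooth_ring_differentiable] smooth_ring.add)
next
  case (mult f g)
  then show ?case
    by (simp only: partial_mult[OF smooth_ring_differentiable smooth_ring_differentiable]
        smooth_ring.add smooth_ring.mult)
qed

lemma smooth_ring_smooth: "smooth_ring f \<Longrightarrow> smooth f"
  by (rule smooth_coinduct[of _ "Collect smooth_ring"]) (auto simp: smooth_ring_differentiable smooth_ring_partial)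

lemma smooth_add: "smooth f \<Longrightarrow> smooth g \<Longrightarrow> smooth (f + g)"
  and smooth_mult: "smooth f \<Longrightarrow> smooth g \<Longrightarrow> smooth (f * g)"
  by (simp_all add: smooth_ring_smooth smooth_ring.intros)

lemma smooth_const: "smooth (\<lambda>p. c)"
proof (rule smooth_coinduct)
  show "(\<lambda>p. c) \<in> range (\<lambda>c p. c)" by simp
qed (auto simp: partial_const zero_fun_def)

lemma smooth_zero: "smooth 0" and smooth_numeral: "smooth (numeral n)"
proof -
  have "0 = (\<lambda>p::real^2. 0::real)" "numeral n = (\<lambda>p::real^2. numeral n::real)"
    by (simp_all add: fun_eq_iff)
  then show "smooth 0" "smooth (numeral n)"
    by (metis smooth_const)+
qed

lemma smooth_minus: "smooth f \<Longrightarrow> smooth (- f)"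
  using smooth_mult[OF smooth_const[of "- 1"], of f] by (simp add: times_fun_def fun_Compl_def)

lemma smooth_diff: "smooth f \<Longrightarrow> smooth g \<Longrightarrow> smooth (f - g)"
  using smooth_add[OF _ smooth_minus, of f g] by simp

lemma partial_coordinate: "partial i (\<lambda>p. p $ j) = (\<lambda>p. if i = j then 1 else 0)"
  by (auto simp: partial_def axis_def fun_eq_iff intro!: DERIV_imp_deriv derivative_eq_intros)

lemma smooth_coordinate: "smooth (\<lambda>p. p $ j)"
proof (rule smooth_coinduct)
  let ?S = "insert (\<lambda>p. p $ j) (range (\<lambda>c p. c))"
  show "(\<lambda>p. p $ j) \<in> ?S" by simp
  show "g differentiable_on UNIV" if "g \<in> ?S" for g :: fn
    using that linear_imp_differentiable_on[OF bounded_linear.linear[OF bounded_linear_vec_nth[of j]]]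
    by (auto simp: differentiable_on_const)
  show "partial i g \<in> ?S" if "g \<in> ?S" for g :: fn and i
    using that by (auto simp: partial_coordinate partial_const zero_fun_def)
qed

lemmas smooth_intros = smooth_partial smooth_add smooth_mult smooth_minus smooth_diff
  smooth_zero smooth_numeral smooth_const smooth_coordinate

lemma smooth_partial_add: "smooth f \<Longrightarrow> smooth g \<Longrightarrow> partial i (f + g) = partial i f + partial i g"
  and smooth_partial_mult: "smooth f \<Longrightarrow> smooth g \<Longrightarrow> partial i (f * g) = partial i f * g + f * partial i g"
  and smooth_partial_diff: "smooth f \<Longrightarrow> smooth g \<Longrightarrow> partial i (f - g) = partial i f - partial i g"
  and partial_numeral: "partial i (numeral n) = 0"
proof -
  assume f: "smooth f" "smooth g"
  then show "partial i (f + g) = partial i f + partial i g"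
    and "partial i (f * g) = partial i f * g + f * partial i g"
    by (simp_all add: partial_add partial_mult smooth_differentiable)
  show "partial i (f - g) = partial i f - partial i g"
    using f partial_add[of f "- g" i] by (simp add: smooth_differentiable smooth_minus partial_minus)
next
  have "numeral n = (\<lambda>p::real^2. numeral n::real)"
    by (simp add: fun_eq_iff)
  then show "partial i (numeral n) = 0"
    by (metis partial_const)
qed

lemmas partial_simps = smooth_intros smooth_partial_add smooth_partial_mult smooth_partial_diff
  partial_minus partial_zero partial_numeral partial_const

section \<open>The tetrahedral flow\<close>

lemma Poisson_eq: "Poisson \<rho> = MV 0 0 0 \<rho>"
  by (simp add: Poisson_def scal_def xi_def)

text \<open>Edge operators act factor by factor and the final product reads factors 1 to 4 only.
  This allows families of factors to be replaced by \<open>tensor4\<close>.\<close>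

lemma contract_cong:
  assumes "\<And>v. v \<in> {1..4} \<Longrightarrow> F v = G v"
  shows "contract es F = contract es G"
  using assms
proof (induction es F arbitrary: G rule: contract.induct)
  case (1 F)
  then show ?case by simp
next
  case (2 a b es F)
  have "contract es (dxi_at c i (dx_at d i F)) = contract es (dxi_at c i (dx_at d i G))"
    if "(c, d) = (a, b) \<or> (c, d) = (b, a)" for c d i
    using that by (elim disjE; clarsimp; intro 2; simp add: dxi_at_def dx_at_def 2)
  then show ?case by simp
qed

lemma contract_zero:
  assumes "F v = 0" "v \<in> {1..4}"
  shows "contract es F = 0"
  using assms(1)
proof (induction es arbitrary: F)
  case Nil
  have "v = 1 \<or> v = 2 \<or> v = 3 \<or> v = 4" using assms(2) by auto
  with Nil show ?case by auto
next
  case (Cons e es)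
  have "dxi_at a i (dx_at b i F) v = 0" for a b i
    using Cons.prems by (auto simp: dxi_at_def dx_at_def zero_mvf_def partial_zero)
  then show ?case
    by (cases e) (simp add: Cons.IH)
qed

text \<open>Four explicit arguments give rewriting a normal form, where edge operators would
  otherwise pile up nested function updates.\<close>

definition tensor4 :: "mvf \<Rightarrow> mvf \<Rightarrow> mvf \<Rightarrow> mvf \<Rightarrow> nat \<Rightarrow> mvf" where
  "tensor4 A B C D v = (if v = 1 then A else if v = 2 then B else if v = 3 then C else D)"

text \<open>
  Most of the \<open>4 ^ 6\<close> terms of the flow vanish because a factor is hit by three odd derivatives or
  twice by the same one; discarding them at that point keeps the expansion by rewriting small.
\<close>

lemma contract_tensor4_zero:
  "contract es (tensor4 (MV 0 0 0 0) B C D) = 0"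
  "contract es (tensor4 A (MV 0 0 0 0) C D) = 0"
  "contract es (tensor4 A B (MV 0 0 0 0) D) = 0"
  "contract es (tensor4 A B C (MV 0 0 0 0)) = 0"
  unfolding zero_mvf_def[symmetric]
  by (rule contract_zero[of _ 1] contract_zero[of _ 2] contract_zero[of _ 3] contract_zero[of _ 4];
      simp add: tensor4_def; fail)+

text \<open>One rewrite rule per edge of the tetrahedron; \<open>parity\<close> on the factors left
  of the odd derivative is its Koszul sign.\<close>

lemma contract_tensor4:
  "contract [] (tensor4 A B C D) = A * B * C * D"
  "contract ((1, 2) # es) (tensor4 A B C D) = 
    (\<Sum>i\<in>UNIV. contract es (tensor4 (dxi i A) (dx i B) C D) +
      contract es (tensor4 (parity (dx i A)) (dxi i B) C D))"
  "contract ((1, 3) # es) (tensor4 A B C D) = 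
    (\<Sum>i\<in>UNIV. contract es (tensor4 (dxi i A) B (dx i C) D) +
      contract es (tensor4 (parity (dx i A)) (parity B) (dxi i C) D))"
  "contract ((1, 4) # es) (tensor4 A B C D) = 
    (\<Sum>i\<in>UNIV. contract es (tensor4 (dxi i A) B C (dx i D)) +
      contract es (tensor4 (parity (dx i A)) (parity B) (parity C) (dxi i D)))"
  "contract ((2, 3) # es) (tensor4 A B C D) = 
    (\<Sum>i\<in>UNIV. contract es (tensor4 (parity A) (dxi i B) (dx i C) D) +
      contract es (tensor4 (parity A) (parity (dx i B)) (dxi i C) D))"
  "contract ((2, 4) # es) (tensor4 A B C D) = 
    (\<Sum>i\<in>UNIV. contract es (tensor4 (parity A) (dxi i B) C (dx i D)) +
      contract es (tensor4 (parity A) (parity (dx i B)) (parity C) (dxi i D)))"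
  "contract ((3, 4) # es) (tensor4 A B C D) = 
    (\<Sum>i\<in>UNIV. contract es (tensor4 (parity A) (parity B) (dxi i C) (dx i D)) +
      contract es (tensor4 (parity A) (parity B) (parity (dx i C)) (dxi i D)))"
  by (simp add: tensor4_def)
    (simp only: contract.simps; intro sum.cong refl arg_cong2[of _ _ _ _ "(+)"] contract_cong;
       auto simp: tensor4_def dxi_at_def dx_at_def)+

lemma two_neq_one: "(2::2) \<noteq> 1"
  by simp

text \<open>The bracketed form is D D D \<rho> for D = \<rho>_y d_x - \<rho>_x d_y with the
  coefficients of D kept outside the derivatives. The factor 8 counts the orientations in which one
  of the four vertices receives three edges and the other three form one of two directed cycles.
  Contributions with in-degrees 2, 2, 1, 1 cancel.\<close>

lemma tetrahedral_flow_Poisson: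
  assumes "smooth \<rho>"
  shows "tetrahedral_flow (Poisson \<rho>) = MV 0 0 0 (8 *
    (partial 2 \<rho> * partial 2 \<rho> * partial 2 \<rho> * partial 1 (partial 1 (partial 1 \<rho>))
     - 3 * partial 2 \<rho> * partial 2 \<rho> * partial 1 \<rho> * partial 1 (partial 1 (partial 2 \<rho>))
     + 3 * partial 1 \<rho> * partial 1 \<rho> * partial 2 \<rho> * partial 1 (partial 2 (partial 2 \<rho>))
     - partial 1 \<rho> * partial 1 \<rho> * partial 1 \<rho> * partial 2 (partial 2 (partial 2 \<rho>))))"
    (is "_ = ?flow")
proof -
  have "tetrahedral_flow (Poisson \<rho>) = contract [(1,2), (1,3), (1,4), (2,3), (2,4), (3,4)]
      (tensor4 (MV 0 0 0 \<rho>) (MV 0 0 0 \<rho>) (MV 0 0 0 \<rho>) (MV 0 0 0 \<rho>))"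
    unfolding tetrahedral_flow_def Poisson_eq by (rule contract_cong) (simp add: tensor4_def)
  also have "\<dots> = ?flow"
    using assms
    by (simp only: contract_tensor4 sum_2 contract_tensor4_zero dxi.simps dx.simps parity.simps
        partial_zero partial_minus smooth_partial partial_2_1 minus_zero minus_minus
        if_True if_False simp_thms two_neq_one add_0 add_0_right)
      (simp add: zero_mvf_def)
  finally show ?thesis .
qed

section \<open>Evaluation of graphs\<close>

lemma sum_lists_length_Suc:
  fixes F :: "'a::finite list \<Rightarrow> 'b::comm_monoid_add"
  shows "(\<Sum>xs\<in>{xs. length xs = Suc n}. F xs) = (\<Sum>x\<in>UNIV. \<Sum>xs\<in>{xs. length xs = n}. F (x # xs))"
proof -
  have "{xs :: 'a list. length xs = Suc n} = (\<lambda>(x, xs). x # xs) ` (UNIV \<times> {xs. length xs = n})"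
    by (auto simp: length_Suc_conv)
  moreover have "inj_on (\<lambda>(x, xs). x # xs) (UNIV \<times> {xs :: 'a list. length xs = n})"
    by (auto simp: inj_on_def)
  ultimately show ?thesis
    by (simp add: sum.reindex sum.cartesian_product case_prod_beta')
qed

lemma sum_UNIV_pairs_2:
  fixes F :: "2 \<times> 2 \<Rightarrow> 'b::comm_monoid_add"
  shows "(\<Sum>x\<in>UNIV. F x) = F (1, 1) + F (1, 2) + F (2, 1) + F (2, 2)"
proof -
  have "(UNIV :: (2 \<times> 2) set) = {(1, 1), (1, 2), (2, 1), (2, 2)}"
    by (auto simp: UNIV_2 UNIV_Times_UNIV[symmetric] simp del: UNIV_Times_UNIV)
  then have "sum F UNIV = sum F {(1, 1), (1, 2), (2, 1), (2, 2)}"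
    by (rule arg_cong)
  then show ?thesis
    by (simp add: add.assoc)
qed

lemma levi_civita_simps:
  "levi_civita 1 1 = 0" "levi_civita 1 2 = 1" "levi_civita 2 1 = -1" "levi_civita 2 2 = 0"
  by (simp_all add: levi_civita_def)

lemma scal_mult: "scal f * scal g = scal (f * g)"
  by (simp add: scal_def)

lemma scal_mult_xi: "scal f * xi 1 = MV 0 f 0 0" "scal f * xi 2 = MV 0 0 f 0"
  by (simp_all add: scal_def xi_def)

text \<open>Swapping the decorations along with the edges is an involution on decorations. Because
  the two targets differ, at most one of the two edges enters any given vertex, so every list of
  incoming indices is unchanged and only the Levi-Civita factor of \<open>k\<close> changes
  sign.\<close>

lemma phi_swap:
  assumes g: "fst (g ! k) \<noteq> snd (g ! k)" and k: "k < length g"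
  shows "phi (g[k := prod.swap (g ! k)]) \<rho> = - phi g \<rho>"
proof -
  let ?s = "\<lambda>is. is[k := prod.swap (is ! k)] :: (2 \<times> 2) list"
  let ?L = "{is :: (2 \<times> 2) list. length is = length g}"
  have inc: "incoming (g[k := prod.swap (g ! k)]) (?s is) v = incoming g is v" if "is \<in> ?L" for "is" v
  proof -
    have "map2 (\<lambda>(s, t) (i, j). (if s = v then [i] else []) @ (if t = v then [j] else []))
        (g[k := prod.swap (g ! k)]) (?s is)
      = map2 (\<lambda>(s, t) (i, j). (if s = v then [i] else []) @ (if t = v then [j] else [])) g is"
      (is "?l = ?r")
    proof (rule nth_equalityI)
      show "?l ! i = ?r ! i" if "i < length ?l" for i
        using that \<open>is \<in> ?L\<close> g by (cases "i = k") (auto simp: case_prod_beta)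
    qed (use that in simp)
    then show ?thesis by (simp add: incoming_def)
  qed
  have lc: "(\<Prod>(i, j)\<leftarrow>?s is. levi_civita i j) = - (\<Prod>(i, j)\<leftarrow>is. levi_civita i j)" if "is \<in> ?L" for "is"
  proof -
    have anti: "levi_civita j i = - levi_civita i j" for i j
      by (simp add: levi_civita_def)
    have "(\<Prod>(i, j)\<leftarrow>xs @ prod.swap x # ys. levi_civita i j) = - (\<Prod>(i, j)\<leftarrow>xs @ x # ys. levi_civita i j)"
      for xs x ys
      using anti[of "snd x" "fst x"] by (simp add: case_prod_beta)
    from this[of "take k is" "is ! k" "drop (Suc k) is"] show ?thesis
      using that k by (simp only: upd_conv_take_nth_drop mem_Collect_eq id_take_nth_drop[symmetric])
  qed
  let ?F = "\<lambda>g is. (\<Prod>(i, j)\<leftarrow>is. levi_civita i j) *\<^sub>R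
    ((\<Prod>k\<leftarrow>[1..<Suc (length g)]. scal (partials (incoming g is k) \<rho>)) *
      (\<Prod>i\<leftarrow>incoming g is 0. xi i))"
  have bij: "bij_betw ?s ?L ?L"
    using k by (intro bij_betwI[where g = ?s]) auto
  have "phi (g[k := prod.swap (g ! k)]) \<rho> = (\<Sum>is\<in>?L. ?F (g[k := prod.swap (g ! k)]) is)"
    unfolding phi_def by simp
  also have "\<dots> = (\<Sum>is\<in>?L. ?F (g[k := prod.swap (g ! k)]) (?s is))"
    by (rule sum.reindex_bij_betw[OF bij, symmetric])
  also have "\<dots> = (\<Sum>is\<in>?L. - ?F g is)"
    by (intro sum.cong refl) (simp only: inc lc length_list_update scaleR_minus_left)
  also have "\<dots> = - phi g \<rho>"
    unfolding phi_def by (simp only: sum_negf)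
  finally show ?thesis .
qed

section \<open>The three basic vector fields and their combinations\<close>

definition field_A :: "fn \<Rightarrow> mvf" where
  "field_A \<rho> = MV 0
     (\<rho> * partial 2 (partial 2 \<rho>) * partial 1 (partial 1 (partial 2 \<rho>))
       - 2 * \<rho> * partial 1 (partial 2 \<rho>) * partial 1 (partial 2 (partial 2 \<rho>))
       + \<rho> * partial 1 (partial 1 \<rho>) * partial 2 (partial 2 (partial 2 \<rho>)))
     (2 * \<rho> * partial 1 (partial 2 \<rho>) * partial 1 (partial 1 (partial 2 \<rho>))
       - \<rho> * partial 2 (partial 2 \<rho>) * partial 1 (partial 1 (partial 1 \<rho>))
       - \<rho> * partial 1 (partial 1 \<rho>) * partial 1 (partial 2 (partial 2 \<rho>)))
     0"

text \<open>With D = \<rho>_y d_x - \<rho>_x d_y, the components are D D \<rho>_y and - D D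
  \<rho>_x, the coefficients of D being left undifferentiated.\<close>

definition field_B :: "fn \<Rightarrow> mvf" where
  "field_B \<rho> = MV 0
     (partial 2 \<rho> * partial 2 \<rho> * partial 1 (partial 1 (partial 2 \<rho>))
       - 2 * partial 1 \<rho> * partial 2 \<rho> * partial 1 (partial 2 (partial 2 \<rho>))
       + partial 1 \<rho> * partial 1 \<rho> * partial 2 (partial 2 (partial 2 \<rho>)))
     (2 * partial 1 \<rho> * partial 2 \<rho> * partial 1 (partial 1 (partial 2 \<rho>))
       - partial 2 \<rho> * partial 2 \<rho> * partial 1 (partial 1 (partial 1 \<rho>))
       - partial 1 \<rho> * partial 1 \<rho> * partial 1 (partial 2 (partial 2 \<rho>)))
     0"

text \<open>The field \<rho>_y d_x - \<rho>_x d_y times the Hessian determinant of \<rho>.\<close>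

definition field_C :: "fn \<Rightarrow> mvf" where
  "field_C \<rho> = MV 0
     (partial 2 \<rho> * (partial 1 (partial 1 \<rho>) * partial 2 (partial 2 \<rho>) - partial 1 (partial 2 \<rho>) * partial 1 (partial 2 \<rho>)))
     (- partial 1 \<rho> * (partial 1 (partial 1 \<rho>) * partial 2 (partial 2 \<rho>) - partial 1 (partial 2 \<rho>) * partial 1 (partial 2 \<rho>)))
     0"

text \<open>The coefficients are chosen before \<rho>; only for that reason can special choices of
  \<rho> determine them later.\<close>

definition spanned :: "(fn \<Rightarrow> mvf) \<Rightarrow> bool" where
  "spanned X \<longleftrightarrow> (\<exists>a b c. \<forall>\<rho>. smooth \<rho> \<longrightarrow>
     X \<rho> = a *\<^sub>R field_A \<rho> + b *\<^sub>R field_B \<rho> + c *\<^sub>R field_C \<rho>)"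

lemma spannedE:
  assumes "spanned X"
  obtains a b c where "\<And>\<rho>. smooth \<rho> \<Longrightarrow> X \<rho> = a *\<^sub>R field_A \<rho> + b *\<^sub>R field_B \<rho> + c *\<^sub>R field_C \<rho>"
  using assms unfolding spanned_def by blast

lemma spannedI:
  assumes "\<And>\<rho>. smooth \<rho> \<Longrightarrow> X \<rho> = a *\<^sub>R field_A \<rho> + b *\<^sub>R field_B \<rho> + c *\<^sub>R field_C \<rho>"
  shows "spanned X"
  using assms unfolding spanned_def by blast

lemma spanned_add:
  assumes "spanned X" "spanned Y"
  shows "spanned (\<lambda>\<rho>. X \<rho> + Y \<rho>)"
proof -
  obtain a b c a' b' c' where
    "\<And>\<rho>. smooth \<rho> \<Longrightarrow> X \<rho> = a *\<^sub>R field_A \<rho> + b *\<^sub>R field_B \<rho> + c *\<^sub>R field_C \<rho>"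
    "\<And>\<rho>. smooth \<rho> \<Longrightarrow> Y \<rho> = a' *\<^sub>R field_A \<rho> + b' *\<^sub>R field_B \<rho> + c' *\<^sub>R field_C \<rho>"
    using assms by (auto elim!: spannedE)
  then show ?thesis
    by (intro spannedI[where a = "a + a'" and b = "b + b'" and c = "c + c'"])
      (simp add: scaleR_add_left)
qed

lemma spanned_scaleR:
  assumes "spanned X"
  shows "spanned (\<lambda>\<rho>. r *\<^sub>R X \<rho>)"
proof -
  obtain a b c where
    "\<And>\<rho>. smooth \<rho> \<Longrightarrow> X \<rho> = a *\<^sub>R field_A \<rho> + b *\<^sub>R field_B \<rho> + c *\<^sub>R field_C \<rho>"
    using assms by (auto elim!: spannedE)
  then show ?thesis
    by (intro spannedI[where a = "r * a" and b = "r * b" and c = "r * c"])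
      (simp add: scaleR_add_right)
qed

lemmas phi_simps = phi_def sum_lists_length_Suc sum_UNIV_pairs_2 levi_civita_simps incoming_def
  partials_def smooth_partial partial_2_1 scal_mult scal_mult_xi

lemma phi_B: "smooth \<rho> \<Longrightarrow> phi [(0, 1), (1, 3), (1, 2)] \<rho> = field_B \<rho>"
  by (simp add: field_B_def phi_simps) (simp add: fun_eq_iff algebra_simps)

lemma phi_C: "smooth \<rho> \<Longrightarrow> phi [(0, 3), (1, 3), (1, 2)] \<rho> = field_C \<rho>"
  by (simp add: field_C_def phi_simps) (simp add: fun_eq_iff algebra_simps)

section \<open>Reduction to graphs with sorted target pairs\<close>

lemma spanned_phi_swap:
  assumes "fst (g ! k) \<noteq> snd (g ! k)" "k < length g" "spanned (phi (g[k := prod.swap (g ! k)]))"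
  shows "spanned (phi g)"
proof -
  have "(\<lambda>\<rho>. (- 1) *\<^sub>R phi (g[k := prod.swap (g ! k)]) \<rho>) = phi g"
    using phi_swap[OF assms(1,2)] by (simp add: fun_eq_iff)
  then show ?thesis
    using spanned_scaleR[OF assms(3), of "- 1"] by simp
qed

text \<open>Membership in \<open>S\<close> is carried along undirected paths. To refute a
  disconnected graph it suffices to take one of its components as \<open>S\<close>.\<close>

lemma lc_graphs_closed:
  assumes g: "g \<in> lc_graphs sink n" and S: "\<And>u v. (u, v) \<in> edges g \<Longrightarrow> u \<in> S \<longleftrightarrow> v \<in> S"
    and "u \<in> vertices sink n" "u \<in> S" "v \<in> vertices sink n"
  shows "v \<in> S"
proof -
  have "(u, v) \<in> (edges g \<union> (edges g)\<inverse>)\<^sup>*"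
    using assms by (auto simp: lc_graphs_def)
  then show ?thesis
    by (induction rule: rtrancl_induct) (use S \<open>u \<in> S\<close> in auto)
qed

lemma edges_3: "edges [p, q, r] = {1} \<times> {fst p, snd p} \<union> {2} \<times> {fst q, snd q} \<union> {3} \<times> {fst r, snd r}"
proof -
  have "{1..length [p, q, r]} = {1, 2, 3}" by auto
  then show ?thesis
    unfolding edges_def by auto
qed

text \<open>A representative of the target pair up to the sign in \<open>phi_swap\<close>. Sorting
  leaves 81 candidate graphs: three places for the pair with the sink, and three choices for each
  pair.\<close>

definition ordered_pair :: "'a::linorder \<times> 'a \<Rightarrow> 'a \<times> 'a" where
  "ordered_pair p = (if fst p < snd p then p else prod.swap p)"

lemma spanned_phi_update:
  assumes "fst (g ! k) \<noteq> snd (g ! k)" "k < length g" "spanned (phi (g[k := ordered_pair (g ! k)]))"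
  shows "spanned (phi g)"
  using assms spanned_phi_swap[of g k] by (auto simp: ordered_pair_def split: if_splits)

lemma lc_graphs_TrueE:
  assumes "g \<in> lc_graphs True 3"
  obtains p q r where "g = [p, q, r]"
    "\<And>e. e \<in> {p, q, r} \<Longrightarrow> fst e \<noteq> snd e \<and> fst e \<le> 3 \<and> snd e \<le> 3"
    "count_list [fst p, snd p] 0 + count_list [fst q, snd q] 0 + count_list [fst r, snd r] 0 = 1"
proof -
  have len: "length g = 3" and dist: "\<forall>(s, t)\<in>set g. s \<in> {0..3} \<and> t \<in> {0..3} \<and> s \<noteq> t"
    and count: "count_list (map fst g @ map snd g) 0 = 1"
    using assms by (simp_all add: lc_graphs_def vertices_def)
  obtain p q r where g: "g = [p, q, r]"
    using len by (auto simp: numeral_3_eq_3 length_Suc_conv)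
  show thesis
  proof (rule that[OF g])
    show "fst e \<noteq> snd e \<and> fst e \<le> 3 \<and> snd e \<le> 3" if "e \<in> {p, q, r}" for e
      using dist that by (auto simp: g)
    \<comment> \<open>In this additive form the count over all first and then all second targets can
      be regrouped vertex by vertex.\<close>
    have "count_list (x # xs) y = of_bool (x = y) + count_list xs y" for x y :: nat and xs
      by simp
    then show "count_list [fst p, snd p] 0 + count_list [fst q, snd q] 0 + count_list [fst r, snd r] 0 = 1"
      using count unfolding g by (simp only: list.map append.simps count_list.simps(1) add_0_right ac_simps)
  qed
qed

text \<open>The sink is the least label, so after sorting it can only be a first component, and
  counting edges into it becomes a test on \<open>fst\<close>.\<close>

lemma ordered_pair_cases:
  fixes p :: "nat \<times> nat"
  assumes "fst p \<noteq> snd p \<and> fst p \<le> 3 \<and> snd p \<le> 3"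
  shows "ordered_pair p \<in> {(0, 1), (0, 2), (0, 3), (1, 2), (1, 3), (2, 3)}"
    "count_list [fst p, snd p] 0 = of_bool (fst (ordered_pair p) = 0)"
proof -
  obtain a b where p: "p = (a, b)" by fastforce
  have "a \<in> {0, 1, 2, 3}" "b \<in> {0, 1, 2, 3}" "a \<noteq> b" using assms p by auto
  then show "ordered_pair p \<in> {(0, 1), (0, 2), (0, 3), (1, 2), (1, 3), (2, 3)}"
    by (auto simp: p ordered_pair_def)
  show "count_list [fst p, snd p] 0 = of_bool (fst (ordered_pair p) = 0)"
    using assms by (auto simp: p ordered_pair_def)
qed

lemma ordered_pair_eqD: "ordered_pair p = (a, b) \<Longrightarrow> {fst p, snd p} = {a, b}"
  by (cases p) (auto simp: ordered_pair_def split: if_splits)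

section \<open>Values of the 78 connected sorted graphs\<close>

lemma spanned_field_A: "(\<And>\<rho>. smooth \<rho> \<Longrightarrow> X \<rho> = s *\<^sub>R field_A \<rho>) \<Longrightarrow> spanned X"
  and spanned_field_B: "(\<And>\<rho>. smooth \<rho> \<Longrightarrow> X \<rho> = s *\<^sub>R field_B \<rho>) \<Longrightarrow> spanned X"
  and spanned_field_C: "(\<And>\<rho>. smooth \<rho> \<Longrightarrow> X \<rho> = s *\<^sub>R field_C \<rho>) \<Longrightarrow> spanned X"
  using spannedI[of X s 0 0] spannedI[of X 0 s 0] spannedI[of X 0 0 s] by auto

text \<open>For smooth \<rho> the value depends on the three target pairs but not on which vertex
  issues which, so each table is closed under permutation. Here the pattern is (0, t), (a, b), (a,
  b) with t one of a, b; the vertex outside a, b carries the undifferentiated \<rho>.\<close>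

lemma spanned_phi_A_pos:
  assumes "g \<in> {[(0, 1), (1, 2), (1, 2)], [(0, 1), (1, 3), (1, 3)], [(0, 2), (1, 2), (1, 2)],
       [(0, 2), (2, 3), (2, 3)], [(0, 3), (1, 3), (1, 3)], [(0, 3), (2, 3), (2, 3)],
       [(1, 2), (0, 1), (1, 2)], [(1, 2), (0, 2), (1, 2)], [(1, 2), (1, 2), (0, 1)],
       [(1, 2), (1, 2), (0, 2)], [(1, 3), (0, 1), (1, 3)], [(1, 3), (0, 3), (1, 3)],
       [(1, 3), (1, 3), (0, 1)], [(1, 3), (1, 3), (0, 3)], [(2, 3), (0, 2), (2, 3)],
       [(2, 3), (0, 3), (2, 3)], [(2, 3), (2, 3), (0, 2)], [(2, 3), (2, 3), (0, 3)]}"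
  shows "spanned (phi g)"
proof (rule spanned_field_A[of _ "1"])
  show "phi g \<rho> = (1) *\<^sub>R field_A \<rho>" if "smooth \<rho>" for \<rho>
    using assms that
    by (elim insertE emptyE; simp add: field_A_def phi_simps; simp add: fun_eq_iff algebra_simps)
qed

text \<open>In type B one vertex is a target of all three pairs. The sign is negative when it is 2,
  which stands second in (1, 2) but first in (2, 3).\<close>

lemma spanned_phi_B_neg:
  assumes "g \<in> {[(0, 2), (1, 2), (2, 3)], [(0, 2), (2, 3), (1, 2)], [(1, 2), (0, 2), (2, 3)],
       [(1, 2), (2, 3), (0, 2)], [(2, 3), (0, 2), (1, 2)], [(2, 3), (1, 2), (0, 2)]}"
  shows "spanned (phi g)"
proof (rule spanned_field_B[of _ "- 1"])
  show "phi g \<rho> = (- 1) *\<^sub>R field_B \<rho>" if "smooth \<rho>" for \<rho>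
    using assms that
    by (elim insertE emptyE; simp add: field_B_def phi_simps; simp add: fun_eq_iff algebra_simps)
qed

lemma spanned_phi_B_pos:
  assumes "g \<in> {[(0, 1), (1, 2), (1, 3)], [(0, 1), (1, 3), (1, 2)], [(0, 3), (1, 3), (2, 3)],
       [(0, 3), (2, 3), (1, 3)], [(1, 2), (0, 1), (1, 3)], [(1, 2), (1, 3), (0, 1)],
       [(1, 3), (0, 1), (1, 2)], [(1, 3), (0, 3), (2, 3)], [(1, 3), (1, 2), (0, 1)],
       [(1, 3), (2, 3), (0, 3)], [(2, 3), (0, 3), (1, 3)], [(2, 3), (1, 3), (0, 3)]}"
  shows "spanned (phi g)"
proof (rule spanned_field_B[of _ "1"])
  show "phi g \<rho> = (1) *\<^sub>R field_B \<rho>" if "smooth \<rho>" for \<rho>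
    using assms that
    by (elim insertE emptyE; simp add: field_B_def phi_simps; simp add: fun_eq_iff algebra_simps)
qed

text \<open>The sign has the same origin as for B: the two pairs avoiding the sink are (1, 2) and
  (2, 3), which hold their common target in opposite positions.\<close>

lemma spanned_phi_C_neg:
  assumes "g \<in> {[(0, 1), (1, 2), (2, 3)], [(0, 1), (2, 3), (1, 2)], [(0, 3), (1, 2), (2, 3)],
       [(0, 3), (2, 3), (1, 2)], [(1, 2), (0, 1), (2, 3)], [(1, 2), (0, 3), (2, 3)],
       [(1, 2), (2, 3), (0, 1)], [(1, 2), (2, 3), (0, 3)], [(2, 3), (0, 1), (1, 2)],
       [(2, 3), (0, 3), (1, 2)], [(2, 3), (1, 2), (0, 1)], [(2, 3), (1, 2), (0, 3)]}"
  shows "spanned (phi g)"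
proof (rule spanned_field_C[of _ "- 1"])
  show "phi g \<rho> = (- 1) *\<^sub>R field_C \<rho>" if "smooth \<rho>" for \<rho>
    using assms that
    by (elim insertE emptyE; simp add: field_C_def phi_simps; simp add: fun_eq_iff algebra_simps)
qed

lemma spanned_phi_C_pos:
  assumes "g \<in> {[(0, 1), (1, 3), (2, 3)], [(0, 1), (2, 3), (1, 3)], [(0, 2), (1, 2), (1, 3)],
       [(0, 2), (1, 3), (1, 2)], [(0, 2), (1, 3), (2, 3)], [(0, 2), (2, 3), (1, 3)],
       [(0, 3), (1, 2), (1, 3)], [(0, 3), (1, 3), (1, 2)], [(1, 2), (0, 2), (1, 3)],
       [(1, 2), (0, 3), (1, 3)], [(1, 2), (1, 3), (0, 2)], [(1, 2), (1, 3), (0, 3)],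
       [(1, 3), (0, 1), (2, 3)], [(1, 3), (0, 2), (1, 2)], [(1, 3), (0, 2), (2, 3)],
       [(1, 3), (0, 3), (1, 2)], [(1, 3), (1, 2), (0, 2)], [(1, 3), (1, 2), (0, 3)],
       [(1, 3), (2, 3), (0, 1)], [(1, 3), (2, 3), (0, 2)], [(2, 3), (0, 1), (1, 3)],
       [(2, 3), (0, 2), (1, 3)], [(2, 3), (1, 3), (0, 1)], [(2, 3), (1, 3), (0, 2)]}"
  shows "spanned (phi g)"
proof (rule spanned_field_C[of _ "1"])
  show "phi g \<rho> = (1) *\<^sub>R field_C \<rho>" if "smooth \<rho>" for \<rho>
    using assms that
    by (elim insertE emptyE; simp add: field_C_def phi_simps; simp add: fun_eq_iff algebra_simps)
qed

text \<open>A repeated pair (a, b) with neither vertex hit by the remaining edge contracts two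
  Hessians completely, which gives twice the determinant.\<close>

lemma spanned_phi_C_double:
  assumes "g \<in> {[(0, 2), (1, 3), (1, 3)], [(0, 3), (1, 2), (1, 2)], [(1, 2), (0, 3), (1, 2)],
       [(1, 3), (1, 3), (0, 2)], [(2, 3), (0, 1), (2, 3)], [(2, 3), (2, 3), (0, 1)]}"
  shows "spanned (phi g)"
proof (rule spanned_field_C[of _ "2"])
  show "phi g \<rho> = (2) *\<^sub>R field_C \<rho>" if "smooth \<rho>" for \<rho>
    using assms that
    by (elim insertE emptyE; simp add: field_C_def phi_simps; simp add: fun_eq_iff algebra_simps)
qed
text \<open>The three excluded graphs are disconnected: the vertex above the sink is joined to the sink only.\<close>

lemma spanned_phi_ordered:
  assumes "p \<in> {(0, 1), (0, 2), (0, 3), (1, 2), (1, 3), (2, 3)}"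
    "q \<in> {(0, 1), (0, 2), (0, 3), (1, 2), (1, 3), (2, 3)}"
    "r \<in> {(0, 1), (0, 2), (0, 3), (1, 2), (1, 3), (2, 3)}"
    "of_bool (fst p = 0) + of_bool (fst q = 0) + of_bool (fst r = 0) = (1 :: nat)"
    "(p, q, r) \<notin> {((0, 1), (2, 3), (2, 3)), ((1, 3), (0, 2), (1, 3)), ((1, 2), (1, 2), (0, 3))}"
  shows "spanned (phi [p, q, r])"
proof -
  let ?Z = "{(0, 1), (0, 2), (0, 3)} :: (nat \<times> nat) set"
  let ?N = "{(1, 2), (1, 3), (2, 3)} :: (nat \<times> nat) set"
  have "e \<in> ?Z \<and> fst e = 0 \<or> e \<in> ?N \<and> fst e \<noteq> 0" 
    if "e \<in> {(0, 1), (0, 2), (0, 3), (1, 2), (1, 3), (2, 3)}" for e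
    using that by auto
  from this[OF assms(1)] this[OF assms(2)] this[OF assms(3)] assms(4)
  have "p \<in> ?Z \<and> q \<in> ?N \<and> r \<in> ?N \<or> p \<in> ?N \<and> q \<in> ?Z \<and> r \<in> ?N \<or> p \<in> ?N \<and> q \<in> ?N \<and> r \<in> ?Z"
    by (elim disjE conjE) simp_all
  then show ?thesis
    using assms(5)
    \<comment> \<open>All 81 triples are listed: the three excluded ones contradict the assumption,
      every other one occurs in exactly one table.\<close>
    apply (elim disjE conjE insertE emptyE; simp only:)
    apply ((simp; fail) |
      (rule spanned_phi_A_pos; simp; fail) | (rule spanned_phi_C_pos; simp; fail) |
      (rule spanned_phi_C_neg; simp; fail) | (rule spanned_phi_B_pos; simp; fail) |
      (rule spanned_phi_B_neg; simp; fail) | (rule spanned_phi_C_double; simp; fail))+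
    done
qed

lemma spanned_phi:
  assumes "g \<in> lc_graphs True 3"
  shows "spanned (phi g)"
proof -
  obtain p q r where g: "g = [p, q, r]" and
    e: "\<And>e. e \<in> {p, q, r} \<Longrightarrow> fst e \<noteq> snd e \<and> fst e \<le> 3 \<and> snd e \<le> 3" and
    count: "count_list [fst p, snd p] 0 + count_list [fst q, snd q] 0 + count_list [fst r, snd r] 0 = 1"
    using lc_graphs_TrueE[OF assms(1)] by blast
  have conn: "v \<in> S" if "\<forall>(u, v)\<in>edges g. u \<in> S \<longleftrightarrow> v \<in> S" "0 \<in> S" "v \<le> 3" for v S
    using lc_graphs_closed[OF assms(1), of S 0 v] that by (auto simp: vertices_def)
  let ?p = "ordered_pair p" and ?q = "ordered_pair q" and ?r = "ordered_pair r"
  have "\<not> (?p = (0, 1) \<and> ?q = (2, 3) \<and> ?r = (2, 3))"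
  proof safe
    \<comment> \<open>The set {0, 1} is the component of the sink, and connectedness would force
      vertex 2 into it. The two cases below are analogous.\<close>
    assume "?p = (0, 1)" "?q = (2, 3)" "?r = (2, 3)"
    then have "edges g = {1} \<times> {0, 1} \<union> {2} \<times> {2, 3} \<union> {3} \<times> {2, 3}"
      unfolding g edges_3 by (simp only: ordered_pair_eqD)
    then show False
      using conn[of "{0, 1}" 2] by auto
  qed
  moreover have "\<not> (?p = (1, 3) \<and> ?q = (0, 2) \<and> ?r = (1, 3))"
  proof safe
    assume "?p = (1, 3)" "?q = (0, 2)" "?r = (1, 3)"
    then have "edges g = {1} \<times> {1, 3} \<union> {2} \<times> {0, 2} \<union> {3} \<times> {1, 3}"
      unfolding g edges_3 by (simp only: ordered_pair_eqD)
    then show False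
      using conn[of "{0, 2}" 1] by auto
  qed
  moreover have "\<not> (?p = (1, 2) \<and> ?q = (1, 2) \<and> ?r = (0, 3))"
  proof safe
    assume "?p = (1, 2)" "?q = (1, 2)" "?r = (0, 3)"
    then have "edges g = {1} \<times> {1, 2} \<union> {2} \<times> {1, 2} \<union> {3} \<times> {0, 3}"
      unfolding g edges_3 by (simp only: ordered_pair_eqD)
    then show False
      using conn[of "{0, 3}" 1] by auto
  qed
  moreover have "of_bool (fst ?p = 0) + of_bool (fst ?q = 0) + of_bool (fst ?r = 0) = (1 :: nat)"
    using count e by (simp only: ordered_pair_cases(2) insert_iff simp_thms)
  ultimately have "spanned (phi [?p, ?q, ?r])"
    using e by (intro spanned_phi_ordered ordered_pair_cases(1)) auto
  \<comment> \<open>The sorting is undone one vertex at a time, from the last to the first.\<close>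
  then show ?thesis
    using spanned_phi_update[of "[?p, ?q, r]" 2] spanned_phi_update[of "[?p, q, r]" 1]
      spanned_phi_update[of "[p, q, r]" 0] e
    unfolding g by simp
qed

section \<open>Brackets with the Poisson bivector\<close>

text \<open>For X = (u, v) this is \<rho> div X - X(\<rho>), minus the Lie derivative of P along
  X.\<close>

lemma Poisson_bracket_vector:
  "\<lbrakk>Poisson \<rho>, MV 0 u v 0\<rbrakk>\<^sub>S
     = MV 0 0 0 (\<rho> * (partial 1 u + partial 2 v) - u * partial 1 \<rho> - v * partial 2 \<rho>)"
  by (simp add: schouten_def Poisson_eq sum_2 partial_zero) (simp add: algebra_simps)

lemma Poisson_bracket_function:
  "\<lbrakk>Poisson \<rho>, MV h 0 0 0\<rbrakk>\<^sub>S = MV 0 (\<rho> * partial 2 h) (- \<rho> * partial 1 h) 0"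
  by (simp add: schouten_def Poisson_eq sum_2 partial_zero)

text \<open>Scaling becomes multiplication by a constant function, to which the product rule for
  \<open>partial\<close> applies; hence \<open>scaleR_mvf.simps\<close> is disabled wherever this
  rule rewrites.\<close>

lemma scaleR_MV: "r *\<^sub>R MV f u v w = MV ((\<lambda>_. r) * f) ((\<lambda>_. r) * u) ((\<lambda>_. r) * v) ((\<lambda>_. r) * w)"
  by (simp add: times_fun_def)

lemma phi_hessian: "smooth \<rho> \<Longrightarrow> phi [(1, 2), (1, 2)] \<rho> =
    MV (2 * (partial 1 (partial 1 \<rho>) * partial 2 (partial 2 \<rho>) - partial 1 (partial 2 \<rho>) * partial 1 (partial 2 \<rho>))) 0 0 0"
  by (simp add: phi_simps) (simp add: scal_def fun_eq_iff algebra_simps)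

lemma bracket_hessian:
  assumes "smooth \<rho>"
  shows "\<lbrakk>Poisson \<rho>, (r / 2) *\<^sub>R phi [(1, 2), (1, 2)] \<rho>\<rbrakk>\<^sub>S = r *\<^sub>R field_A \<rho>"
  unfolding phi_hessian[OF assms] using assms
  by (simp add: scaleR_MV Poisson_bracket_function field_A_def partial_simps partial_2_1 del: scaleR_mvf.simps)
    (simp add: fun_eq_iff algebra_simps)

text \<open>An instance of [P, [P, H]] = 0, checked here by direct expansion.\<close>

lemma bracket_field_A: "smooth \<rho> \<Longrightarrow> \<lbrakk>Poisson \<rho>, field_A \<rho>\<rbrakk>\<^sub>S = 0"
  unfolding field_A_def Poisson_bracket_vector zero_mvf_def
  by (simp add: partial_simps partial_2_1) (simp add: algebra_simps)

text \<open>The multiple of \<rho> in the first summand is exactly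
  \<open>- 2 * bracket_C \<rho>\<close>, and the last four terms are one eighth of the tetrahedral
  flow.\<close>

definition bracket_B :: "fn \<Rightarrow> fn" where
  "bracket_B \<rho> =
    \<rho> * (4 * partial 2 \<rho> * partial 1 (partial 2 \<rho>) * partial 1 (partial 1 (partial 2 \<rho>))
       - 4 * partial 1 \<rho> * partial 1 (partial 2 \<rho>) * partial 1 (partial 2 (partial 2 \<rho>))
       - 2 * partial 2 \<rho> * partial 1 (partial 1 \<rho>) * partial 1 (partial 2 (partial 2 \<rho>))
       + 2 * partial 1 \<rho> * partial 1 (partial 1 \<rho>) * partial 2 (partial 2 (partial 2 \<rho>))
       - 2 * partial 2 \<rho> * partial 2 (partial 2 \<rho>) * partial 1 (partial 1 (partial 1 \<rho>))
       + 2 * partial 1 \<rho> * partial 2 (partial 2 \<rho>) * partial 1 (partial 1 (partial 2 \<rho>)))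
    - 3 * partial 1 \<rho> * partial 2 \<rho> * partial 2 \<rho> * partial 1 (partial 1 (partial 2 \<rho>))
    + 3 * partial 1 \<rho> * partial 1 \<rho> * partial 2 \<rho> * partial 1 (partial 2 (partial 2 \<rho>))
    - partial 1 \<rho> * partial 1 \<rho> * partial 1 \<rho> * partial 2 (partial 2 (partial 2 \<rho>))
    + partial 2 \<rho> * partial 2 \<rho> * partial 2 \<rho> * partial 1 (partial 1 (partial 1 \<rho>))"

text \<open>The field D = \<rho>_y d_x - \<rho>_x d_y is divergence-free and annihilates \<rho>, so
  what remains is \<rho> times D applied to the Hessian determinant.\<close>

definition bracket_C :: "fn \<Rightarrow> fn" where
  "bracket_C \<rho> =
    \<rho> * (partial 2 \<rho> * partial 2 (partial 2 \<rho>) * partial 1 (partial 1 (partial 1 \<rho>))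
       + partial 2 \<rho> * partial 1 (partial 1 \<rho>) * partial 1 (partial 2 (partial 2 \<rho>))
       - 2 * partial 2 \<rho> * partial 1 (partial 2 \<rho>) * partial 1 (partial 1 (partial 2 \<rho>))
       - partial 1 \<rho> * partial 1 (partial 1 \<rho>) * partial 2 (partial 2 (partial 2 \<rho>))
       - partial 1 \<rho> * partial 2 (partial 2 \<rho>) * partial 1 (partial 1 (partial 2 \<rho>))
       + 2 * partial 1 \<rho> * partial 1 (partial 2 \<rho>) * partial 1 (partial 2 (partial 2 \<rho>)))"

lemma bracket_field_B: "smooth \<rho> \<Longrightarrow> \<lbrakk>Poisson \<rho>, field_B \<rho>\<rbrakk>\<^sub>S = MV 0 0 0 (bracket_B \<rho>)"
  unfolding field_B_def bracket_B_def Poisson_bracket_vector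
  by (simp add: partial_simps partial_2_1) (simp add: algebra_simps)

lemma bracket_field_C: "smooth \<rho> \<Longrightarrow> \<lbrakk>Poisson \<rho>, field_C \<rho>\<rbrakk>\<^sub>S = MV 0 0 0 (bracket_C \<rho>)"
  unfolding field_C_def bracket_C_def Poisson_bracket_vector
  by (simp add: partial_simps partial_2_1) (simp add: algebra_simps)

section \<open>Independence of the brackets of B and C\<close>

text \<open>At the origin the value is \<alpha>, the derivatives y, yy and xxx equal 1, and all
  others up to order three vanish. Only the monomials \<rho> \<rho>_y \<rho>_yy \<rho>_xxx and
  \<rho>_y^3 \<rho>_xxx survive, and \<alpha> separates them.\<close>

definition test_fn :: "real \<Rightarrow> fn" where
  "test_fn \<alpha> = (\<lambda>_. \<alpha>) + (\<lambda>p. p $ 2) + (\<lambda>_. 1 / 2) * (\<lambda>p. p $ 2) * (\<lambda>p. p $ 2)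
     + (\<lambda>_. 1 / 6) * (\<lambda>p. p $ 1) * (\<lambda>p. p $ 1) * (\<lambda>p. p $ 1)"

lemma smooth_test_fn: "smooth (test_fn \<alpha>)"
  by (simp add: test_fn_def smooth_intros)

lemma bracket_test_fn: "bracket_B (test_fn \<alpha>) 0 = 1 - 2 * \<alpha>" "bracket_C (test_fn \<alpha>) 0 = \<alpha>"
  by (simp_all add: bracket_B_def bracket_C_def test_fn_def partial_simps partial_coordinate)

text \<open>A domain on which the bracket with P is linear: additivity of \<open>partial\<close>
  needs differentiable arguments.\<close>

inductive smooth_vector :: "mvf \<Rightarrow> bool" where
  "smooth u \<Longrightarrow> smooth v \<Longrightarrow> smooth_vector (MV 0 u v 0)"

lemma smooth_vector_add: "smooth_vector X \<Longrightarrow> smooth_vector Y \<Longrightarrow> smooth_vector (X + Y)"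
  by (auto simp: smooth_vector.simps smooth_add)

lemma smooth_vector_scaleR: "smooth_vector X \<Longrightarrow> smooth_vector (r *\<^sub>R X)"
  by (auto simp: smooth_vector.simps scaleR_MV smooth_mult smooth_const simp del: scaleR_mvf.simps)

lemma smooth_vector_fields:
  assumes "smooth \<rho>"
  shows "smooth_vector (field_A \<rho>)" "smooth_vector (field_B \<rho>)" "smooth_vector (field_C \<rho>)"
  unfolding field_A_def field_B_def field_C_def
  by (intro smooth_vector.intros smooth_intros assms)+

lemma bracket_add:
  assumes "smooth_vector X" "smooth_vector Y"
  shows "\<lbrakk>Poisson \<rho>, X + Y\<rbrakk>\<^sub>S = \<lbrakk>Poisson \<rho>, X\<rbrakk>\<^sub>S + \<lbrakk>Poisson \<rho>, Y\<rbrakk>\<^sub>S"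
  using assms
  by (auto elim!: smooth_vector.cases simp: Poisson_bracket_vector smooth_partial_add algebra_simps)

lemma bracket_scaleR:
  assumes "smooth_vector X"
  shows "\<lbrakk>Poisson \<rho>, r *\<^sub>R X\<rbrakk>\<^sub>S = r *\<^sub>R \<lbrakk>Poisson \<rho>, X\<rbrakk>\<^sub>S"
  using assms
  by (auto elim!: smooth_vector.cases simp: scaleR_MV Poisson_bracket_vector smooth_partial_mult
      smooth_const partial_const algebra_simps simp del: scaleR_mvf.simps)

lemma bracket_spanned:
  assumes "smooth \<rho>"
  shows "\<lbrakk>Poisson \<rho>, a *\<^sub>R field_A \<rho> + b *\<^sub>R field_B \<rho> + c *\<^sub>R field_C \<rho>\<rbrakk>\<^sub>S
    = MV 0 0 0 (\<lambda>p. b * bracket_B \<rho> p + c * bracket_C \<rho> p)"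
proof -
  have "\<lbrakk>Poisson \<rho>, a *\<^sub>R field_A \<rho> + b *\<^sub>R field_B \<rho> + c *\<^sub>R field_C \<rho>\<rbrakk>\<^sub>S
    = a *\<^sub>R 0 + b *\<^sub>R MV 0 0 0 (bracket_B \<rho>) + c *\<^sub>R MV 0 0 0 (bracket_C \<rho>)"
    using assms by (simp only: bracket_add bracket_scaleR smooth_vector_add smooth_vector_scaleR
        smooth_vector_fields bracket_field_A bracket_field_B bracket_field_C)
  then show ?thesis
    by (simp add: plus_fun_def zero_fun_def)
qed

section \<open>Membership in the spans\<close>

lemma V2D_spanned: "X \<in> V2D \<Longrightarrow> spanned X"
  unfolding V2D_def
proof (induction rule: diffpoly.span_induct_alt)
  case base
  show ?case by (rule spannedI[of _ 0 0 0]) simp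
next
  case (step c x y)
  then show ?case
    using spanned_add[OF spanned_scaleR[OF spanned_phi]] by (auto simp: plus_fun_def)
qed

text \<open>In each graph checked below vertex 1 is adjacent to all others, so any two vertices are
  joined through it.\<close>

lemma rtrancl_star:
  assumes "\<And>w. w \<in> V \<Longrightarrow> w = c \<or> (c, w) \<in> E \<or> (w, c) \<in> E" "u \<in> V" "v \<in> V"
  shows "(u, v) \<in> (E \<union> E\<inverse>)\<^sup>*"
proof -
  have "(u, c) \<in> (E \<union> E\<inverse>)\<^sup>*" "(c, v) \<in> (E \<union> E\<inverse>)\<^sup>*"
    using assms(1)[OF assms(2)] assms(1)[OF assms(3)] by auto
  then show ?thesis
    by (rule rtrancl_trans)
qed

lemma lc_graphs_members:
  "[(0, 1), (1, 3), (1, 2)] \<in> lc_graphs True 3"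
  "[(0, 3), (1, 3), (1, 2)] \<in> lc_graphs True 3"
  "[(1, 2), (1, 2)] \<in> lc_graphs False 2"
proof -
  have V: "vertices True 3 = {0, 1, 2, 3}" "vertices False 2 = {1, 2}"
    by (auto simp: vertices_def)
  have "{1..length [p, q]} = {1, 2}" for p q :: "nat \<times> nat" by auto
  then have E: "edges [p, q] = {1} \<times> {fst p, snd p} \<union> {2} \<times> {fst q, snd q}" for p q
    unfolding edges_def by auto
  show "[(0, 1), (1, 3), (1, 2)] \<in> lc_graphs True 3"
    unfolding lc_graphs_def V edges_3 mem_Collect_eq
    by (intro conjI ballI rtrancl_star[where c = 1 and V = "{0, 1, 2, 3}"]) auto
  show "[(0, 3), (1, 3), (1, 2)] \<in> lc_graphs True 3"
    unfolding lc_graphs_def V edges_3 mem_Collect_eq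
    by (intro conjI ballI rtrancl_star[where c = 1 and V = "{0, 1, 2, 3}"]) auto
  show "[(1, 2), (1, 2)] \<in> lc_graphs False 2"
    unfolding lc_graphs_def V E mem_Collect_eq
    by (intro conjI ballI rtrancl_star[where c = 1 and V = "{1, 2}"]) auto
qed

lemma X_tetra_in_V2D: "X_tetra \<in> V2D"
proof -
  have "(\<lambda>\<rho>. 2 *\<^sub>R phi [(0, 3), (1, 3), (1, 2)] \<rho>) \<in> V2D"
    unfolding V2D_def by (intro diffpoly.span_scale diffpoly.span_base imageI lc_graphs_members)
  moreover have "phi [(0, 1), (1, 3), (1, 2)] \<in> V2D"
    unfolding V2D_def by (intro diffpoly.span_base imageI lc_graphs_members)
  ultimately have "phi [(0, 1), (1, 3), (1, 2)] + (\<lambda>\<rho>. 2 *\<^sub>R phi [(0, 3), (1, 3), (1, 2)] \<rho>) \<in> V2D"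
    unfolding V2D_def by (intro diffpoly.span_add)
  then show ?thesis
    by (simp add: plus_fun_def X_tetra_def[abs_def])
qed

section \<open>Trivialization of the flow and uniqueness\<close>

text \<open>The coefficients 0 and 1 are spelled out so that \<open>bracket_spanned\<close> applies
  literally.\<close>

lemma X_tetra_eq: "smooth \<rho> \<Longrightarrow> X_tetra \<rho> = 0 *\<^sub>R field_A \<rho> + 1 *\<^sub>R field_B \<rho> + 2 *\<^sub>R field_C \<rho>"
  unfolding X_tetra_def by (simp only: phi_B phi_C) simp

lemma tetrahedral_flow_eq:
  assumes "smooth \<rho>"
  shows "(1 / 8) *\<^sub>R tetrahedral_flow (Poisson \<rho>) = \<lbrakk>Poisson \<rho>, X_tetra \<rho>\<rbrakk>\<^sub>S"
  unfolding X_tetra_eq[OF assms] bracket_spanned[OF assms] tetrahedral_flow_Poisson[OF assms] bracket_B_def bracket_C_def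
  by (simp add: fun_eq_iff algebra_simps)

theorem corollary7:
  shows "X_tetra \<in> V2D \<and>
    (\<exists>c::real. c \<noteq> 0 \<and>
      (\<forall>\<rho>. smooth \<rho> \<longrightarrow>
         c *\<^sub>R tetrahedral_flow (Poisson \<rho>) = \<lbrakk>Poisson \<rho>, X_tetra \<rho>\<rbrakk>\<^sub>S) \<and>
      (\<forall>X\<in>V2D.
         (\<forall>\<rho>. smooth \<rho> \<longrightarrow>
            c *\<^sub>R tetrahedral_flow (Poisson \<rho>) = \<lbrakk>Poisson \<rho>, X \<rho>\<rbrakk>\<^sub>S) \<longrightarrow>
         (\<exists>H\<in>H2D. \<forall>\<rho>. smooth \<rho> \<longrightarrow>
            X \<rho> - X_tetra \<rho> = \<lbrakk>Poisson \<rho>, H \<rho>\<rbrakk>\<^sub>S)))"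
proof (intro conjI exI[of _ "1 / 8"] ballI impI allI)
  show "X_tetra \<in> V2D" by (rule X_tetra_in_V2D)
  show "(1 / 8) *\<^sub>R tetrahedral_flow (Poisson \<rho>) = \<lbrakk>Poisson \<rho>, X_tetra \<rho>\<rbrakk>\<^sub>S" if "smooth \<rho>" for \<rho>
    using that by (rule tetrahedral_flow_eq)
  fix X
  assume "X \<in> V2D"
    and sol: "\<forall>\<rho>. smooth \<rho> \<longrightarrow> (1 / 8) *\<^sub>R tetrahedral_flow (Poisson \<rho>) = \<lbrakk>Poisson \<rho>, X \<rho>\<rbrakk>\<^sub>S"
  obtain a b c where X: "\<And>\<rho>. smooth \<rho> \<Longrightarrow> X \<rho> = a *\<^sub>R field_A \<rho> + b *\<^sub>R field_B \<rho> + c *\<^sub>R field_C \<rho>"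
    using spannedE[OF V2D_spanned[OF \<open>X \<in> V2D\<close>]] by blast
  \<comment> \<open>The coefficient \<open>a\<close> drops out because A has zero bracket with P;
    only \<open>b\<close> and \<open>c\<close> are constrained.\<close>
  have eq: "bracket_B \<rho> p + 2 * bracket_C \<rho> p = b * bracket_B \<rho> p + c * bracket_C \<rho> p" if "smooth \<rho>" for \<rho> p
  proof -
    have "\<lbrakk>Poisson \<rho>, X_tetra \<rho>\<rbrakk>\<^sub>S = \<lbrakk>Poisson \<rho>, X \<rho>\<rbrakk>\<^sub>S"
      by (rule trans[OF tetrahedral_flow_eq[OF that, symmetric] sol[rule_format, OF that]])
    then have "(\<lambda>p. 1 * bracket_B \<rho> p + 2 * bracket_C \<rho> p) = (\<lambda>p. b * bracket_B \<rho> p + c * bracket_C \<rho> p)"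
      by (simp only: X X_tetra_eq bracket_spanned that mvf.inject)
    from fun_cong[OF this, of p] show ?thesis
      by simp
  qed
  \<comment> \<open>On the test functions the equation is affine in \<alpha>; its values at 0 and 1
    determine \<open>b\<close> and then \<open>c\<close>.\<close>
  have test: "b * (1 - 2 * \<alpha>) + c * \<alpha> = 1" for \<alpha>
    using eq[OF smooth_test_fn[of \<alpha>], of 0] unfolding bracket_test_fn by linarith
  have b: "b = 1"
    using test[of 0] by simp
  have c: "c = 2"
    using test[of 1] b by simp
  \<comment> \<open>The free coefficient \<open>a\<close> becomes the Hamiltonian; the half offsets
    the factor 2 in \<open>phi_hessian\<close>.\<close>
  let ?H = "\<lambda>\<rho>. (a / 2) *\<^sub>R phi [(1, 2), (1, 2)] \<rho>"
  have "?H \<in> H2D"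
    unfolding H2D_def by (intro diffpoly.span_scale diffpoly.span_base imageI lc_graphs_members)
  moreover have "X \<rho> - X_tetra \<rho> = \<lbrakk>Poisson \<rho>, ?H \<rho>\<rbrakk>\<^sub>S" if "smooth \<rho>" for \<rho>
    unfolding bracket_hessian[OF that] X[OF that] X_tetra_eq[OF that] b c by simp
  ultimately show "\<exists>H\<in>H2D. \<forall>\<rho>. smooth \<rho> \<longrightarrow> X \<rho> - X_tetra \<rho> = \<lbrakk>Poisson \<rho>, H \<rho>\<rbrakk>\<^sub>S"
    by (intro bexI[of _ ?H] allI impI)
qed simp

end
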